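(* Let $p$ be an odd prime. Then $$W_{\frac{p-1}2}\equiv \begin{cases} 4x^2\pmod p&\text{if } p\equiv 1\pmod 4 \text{ and so } p=x^2+y^2 \text{ with } x,y\in\mathbb Z,\ 2\nmid x,\\ 0\pmod p&\text{if } p\equiv 3\pmod 4.\end{cases}$$
   Context: For each nonnegative integer $n$, $W_n=\sum_{k=0}^{[n/3]}\binom{2k}k\binom{3k}k\binom n{3k}(-3)^{n-3k}$, where $[x]$ is the greatest integer not exceeding $x$. *)

theory Defs
  imports "HOL-Number_Theory.Number_Theory"
begin

definition W :: "nat \<Rightarrow> int" where
  "W n = (\<Sum>k = 0..n div 3.
     int ((2 * k) choose k) * int ((3 * k) choose k) * int (n choose (3 * k)) * (-3) ^ (n - 3 * k))"

end

theory Submission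
  imports Defs
begin

text \<open>
  Put \<open>n = (p - 1) div 2\<close> and \<open>m = n div 3\<close>. Modulo \<open>p > 3\<close> one has \<open>n = -1/2\<close> and \<open>m\<close> is \<open>-1/6\<close> or \<open>-5/6\<close>,
  which turns \<open>W n\<close> into \<open>(-3)^n\<close> times the terminating series
  \<open>\<^sub>3F\<^sub>2(-m, m+1, 1/2; 1, 1; 1)\<close>. By Watson's summation the series vanishes for odd \<open>m\<close>, that is for
  \<open>p mod 4 = 3\<close>, and is \<open>(binomial m (m/2))^2 / 4^m\<close> for even \<open>m\<close>. In the latter case Gauss-type
  multiplication formulas for factorials modulo \<open>p\<close> identify \<open>W n\<close> with the square of the central
  binomial coefficient \<open>binomial n (n/2)\<close>. This is \<open>4x^2\<close> by Gauss: the Jacobsthal sum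
  \<open>S(k) = \<Sum>x. \<chi>(x(x^2 - k))\<close> satisfies \<open>S(1)^2 + S(r)^2 = 4p\<close> for a nonresidue \<open>r\<close>, \<open>S(1)/2\<close> is odd,
  and \<open>S(1)\<close> is, up to sign, congruent to the central binomial coefficient.
\<close>

section \<open>A terminating case of Watson's summation\<close>

text \<open>Two one-step shifts in a row. This writes the symbols for \<open>m\<close> and
  \<open>m + 2\<close> over a common base, so that the two series can be compared term by
  term.\<close>

lemma pochhammer_shift_2:
  fixes a :: real
  shows "pochhammer (a + 2) k * (a * (a + 1)) = pochhammer a k * ((a + k) * (a + k + 1))"
proof -
  have *: "pochhammer (b + 1) k * b = pochhammer b k * (b + k)" for b :: real
    by (metis pochhammer_Suc pochhammer_rec mult.commute)
  have "pochhammer (a + 2) k * (a * (a + 1)) = (pochhammer (a + 1 + 1) k * (a + 1)) * a"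
    by (simp add: add.assoc mult_ac)
  also have "\<dots> = (pochhammer (a + 1) k * a) * (a + 1 + k)"
    unfolding *[of "a + 1"] by (simp only: mult_ac)
  also have "\<dots> = pochhammer a k * (a + k) * (a + 1 + k)"
    by (simp only: *)
  finally show ?thesis
    by (simp add: algebra_simps)
qed

text \<open>Without \<open>pochhammer (1/2) k / fact k\<close> these are the coefficients of the
  Legendre polynomial P_m(1 - 2t) in t; that extra factor is the k-th moment of the arcsine
  distribution on [0, 1].\<close>

definition legendre_term :: "nat \<Rightarrow> nat \<Rightarrow> real" where
  "legendre_term m k =
     pochhammer (- real m) k * pochhammer (real m + 1) k * pochhammer (1/2) k / fact k ^ 3"

text \<open>The right-hand side is the Wilf--Zeilberger certificate of the recurrence.\<close>

lemma legendre_term_telescope: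
  "(real m + 2)\<^sup>2 * (\<Sum>k<K. legendre_term (m + 2) k) - (real m + 1)\<^sup>2 * (\<Sum>k<K. legendre_term m k)
   = - 2 * (2 * real m + 3) * real K ^ 3 * pochhammer (- real (m + 2)) K * pochhammer (real m + 1) K
       * pochhammer (1/2) K / (fact K ^ 3 * ((real m + 1) * (real m + 2)))"
proof (induction K)
  case 0
  then show ?case by simp
next
  case (Suc k)
  define u where "u = pochhammer (- real (m + 2)) k"
  define v where "v = pochhammer (real m + 1) k"
  define w where "w = pochhammer (1/2 :: real) k"
  define z where "z = (fact k :: real)"
  define M where "M = (real m + 1) * (real m + 2)"
  have z: "z \<noteq> 0" and M: "M \<noteq> 0" by (auto simp: z_def M_def)
  have 1: "pochhammer (- real m) k = u * ((real k - m - 2) * (real k - m - 1)) / M"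
    using pochhammer_shift_2[of "- real (m + 2)" k] M
    by (simp add: u_def M_def field_simps)
  have 2: "pochhammer (real m + 3) k = v * ((real m + 1 + k) * (real m + 2 + k)) / M"
    using pochhammer_shift_2[of "real m + 1" k] M
    by (simp add: v_def M_def field_simps)
  have t1: "legendre_term (m + 2) k = u * (v * ((real m + 1 + k) * (real m + 2 + k)) / M) * w / z ^ 3"
    unfolding legendre_term_def using 2 by (simp add: u_def w_def z_def add.commute)
  have t2: "legendre_term m k = u * ((real k - m - 2) * (real k - m - 1)) / M * v * w / z ^ 3"
    unfolding legendre_term_def 1 by (simp add: v_def w_def z_def)
  \<comment> \<open>This remains of the induction step once u v w / (z^3 M) is taken out. The last
    three factors are those by which the Pochhammer symbols grow from \<open>k\<close> to
    \<open>Suc k\<close>.\<close>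
  have key: "(real m + 2)\<^sup>2 * ((real m + 1 + k) * (real m + 2 + k)) - (real m + 1)\<^sup>2 * ((real k - m - 2) * (real k - m - 1))
     - 2 * (2 * real m + 3) * real k ^ 3 = - 2 * (2 * real m + 3) * ((real k - m - 2) * (real m + 1 + k) * (1/2 + k))"
    by (simp add: algebra_simps power2_eq_square power3_eq_cube)
  have "(real m + 2)\<^sup>2 * (\<Sum>k<Suc k. legendre_term (m + 2) k) - (real m + 1)\<^sup>2 * (\<Sum>k<Suc k. legendre_term m k)
    = (- 2 * (2 * real m + 3) * real k ^ 3 * u * v * w / (z ^ 3 * M))
      + ((real m + 2)\<^sup>2 * legendre_term (m + 2) k - (real m + 1)\<^sup>2 * legendre_term m k)"
    using Suc by (simp add: algebra_simps u_def v_def w_def z_def M_def)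
  also have "\<dots> = (u * v * w / (z ^ 3 * M)) * ((real m + 2)\<^sup>2 * ((real m + 1 + k) * (real m + 2 + k)) - (real m + 1)\<^sup>2 * ((real k - m - 2) * (real k - m - 1))
     - 2 * (2 * real m + 3) * real k ^ 3)"
    unfolding t1 t2 using z M by (simp add: divide_simps) (simp add: algebra_simps)
  also have "\<dots> = (u * v * w / (z ^ 3 * M)) * (- 2 * (2 * real m + 3) * ((real k - m - 2) * (real m + 1 + k) * (1/2 + k)))"
    by (simp only: key)
  also have "\<dots> = - 2 * (2 * real m + 3) * real (Suc k) ^ 3 * (u * (real k - m - 2)) * (v * (real m + 1 + k))
       * (w * (1/2 + k)) / ((real (Suc k) * z) ^ 3 * M)"
    using z M by (simp add: divide_simps)
  finally show ?case
    by (simp add: pochhammer_Suc u_def v_def w_def z_def M_def algebra_simps)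
qed

lemma legendre_term_eq_0: "m < k \<Longrightarrow> legendre_term m k = 0"
  by (simp add: legendre_term_def pochhammer_of_nat_eq_0_lemma)

text \<open>At \<open>K = m + 3\<close> the certificate contains the zero factor
  \<open>pochhammer (- real (m + 2)) (m + 3)\<close>. The recurrence moves by two in
  \<open>m\<close>, so even and odd \<open>m\<close> are evaluated separately.\<close>

lemma legendre_sum_rec:
  "(real m + 2)\<^sup>2 * (\<Sum>k\<le>m + 2. legendre_term (m + 2) k) = (real m + 1)\<^sup>2 * (\<Sum>k\<le>m. legendre_term m k)"
proof -
  have "pochhammer (- real (m + 2)) (m + 3) = 0"
    by (rule pochhammer_of_nat_eq_0_lemma) simp
  hence "(real m + 2)\<^sup>2 * (\<Sum>k<m+3. legendre_term (m + 2) k) = (real m + 1)\<^sup>2 * (\<Sum>k<m+3. legendre_term m k)"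
    using legendre_term_telescope[of m "m + 3"] by simp
  moreover have "{..<m+3} = {..m+2}" by auto
  moreover have "(\<Sum>k<m+3. legendre_term m k) = (\<Sum>k\<le>m. legendre_term m k)"
    by (rule sum.mono_neutral_right) (auto intro!: legendre_term_eq_0)
  ultimately show ?thesis by simp
qed

lemma central_binomial_Suc: "real ((2 * Suc q) choose (Suc q)) = 4 * (real ((2 * q) choose q) * (2 * real q + 1) / (2 * real q + 2))"
proof -
  have "real ((2 * Suc q) choose (Suc q)) = fact (2 * Suc q) / (fact (Suc q) * fact (2 * Suc q - Suc q))"
    by (rule binomial_fact) simp
  also have "2 * Suc q - Suc q = Suc q" by simp
  also have "2 * Suc q = Suc (Suc (2 * q))" by simp
  also have "fact (Suc (Suc (2 * q))) / (fact (Suc q) * fact (Suc q)) =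
      4 * (fact (2 * q) / (fact q * fact q) * (2 * real q + 1) / (2 * real q + 2))"
    unfolding fact_Suc by (simp add: divide_simps) (simp add: algebra_simps)
  also have "fact (2 * q) / (fact q * fact q) = real ((2 * q) choose q)"
    by (simp add: binomial_fact mult_2)
  finally show ?thesis by simp
qed

text \<open>The recurrence multiplies the sum by ((2q+1)/(2q+2))^2, the square of the ratio of
  consecutive values of binom(2q, q) / 4^q.\<close>

lemma legendre_sum_even:
  "(\<Sum>k\<le>2 * q. legendre_term (2 * q) k) = (real ((2 * q) choose q) / 4 ^ q)\<^sup>2"
proof (induction q)
  case 0
  then show ?case by (simp add: legendre_term_def)
next
  case (Suc q)
  have *: "(2 * real q + 2)\<^sup>2 * (\<Sum>k\<le>2 * Suc q. legendre_term (2 * Suc q) k)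
      = (2 * real q + 1)\<^sup>2 * (real ((2 * q) choose q) / 4 ^ q)\<^sup>2"
    using legendre_sum_rec[of "2 * q"] Suc by simp
  have "(2 * real q + 2)\<^sup>2 * (real ((2 * Suc q) choose (Suc q)) / 4 ^ Suc q)\<^sup>2
      = ((2 * real q + 2) * real ((2 * Suc q) choose (Suc q)) / 4 ^ Suc q)\<^sup>2"
    by (simp add: power_mult_distrib power_divide)
  also have "(2 * real q + 2) * real ((2 * Suc q) choose (Suc q)) / 4 ^ Suc q
      = (2 * real q + 1) * (real ((2 * q) choose q) / 4 ^ q)"
    unfolding central_binomial_Suc by (simp add: divide_simps)
  finally have "(2 * real q + 2)\<^sup>2 * (\<Sum>k\<le>2 * Suc q. legendre_term (2 * Suc q) k)
      = (2 * real q + 2)\<^sup>2 * (real ((2 * Suc q) choose (Suc q)) / 4 ^ Suc q)\<^sup>2"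
    using * by (simp only: power_mult_distrib)
  moreover have "(2 * real q + 2)\<^sup>2 \<noteq> 0" by (simp add: add_nonneg_eq_0_iff)
  ultimately show ?case by (rule mult_left_cancel[THEN iffD1, rotated])
qed

text \<open>The series for \<open>m = 1\<close> is 1 - 1, and the homogeneous recurrence carries
  this zero to every odd index.\<close>

lemma legendre_sum_odd: "(\<Sum>k\<le>2 * q + 1. legendre_term (2 * q + 1) k) = 0"
proof (induction q)
  case 0
  then show ?case by (simp add: legendre_term_def)
next
  case (Suc q)
  have "(real (2 * q + 1) + 2)\<^sup>2 * (\<Sum>k\<le>2 * Suc q + 1. legendre_term (2 * Suc q + 1) k) = 0"
    using legendre_sum_rec[of "2 * q + 1"] Suc by simp
  then show ?case by (simp add: add_nonneg_eq_0_iff)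
qed

text \<open>For \<open>k \<le> m\<close> this is \<open>legendre_term m k\<close> scaled by
  \<open>4 ^ m\<close>, written as a visible integer so that it can enter congruences.\<close>

definition watson_term :: "nat \<Rightarrow> nat \<Rightarrow> int" where
  "watson_term m k = int ((m + k) choose (2 * k)) * (int ((2 * k) choose k))\<^sup>2 * (- 1) ^ k * 4 ^ (m - k)"

lemma real_watson_term:
  assumes "k \<le> m"
  shows "real_of_int (watson_term m k)
           = (- 1) ^ k * 4 ^ (m - k) * fact (m + k) * fact (2 * k) / (fact (m - k) * fact k ^ 4)"
proof -
  have "m + k - 2 * k = m - k" using assms by simp
  thus ?thesis using assms
  by (simp add: watson_term_def binomial_fact divide_simps power2_eq_square power4_eq_xxxx)
qed

lemma legendre_term_closed:
  assumes "k \<le> m"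
  shows "legendre_term m k = (- 1) ^ k * fact (m + k) * fact (2 * k) / (4 ^ k * fact (m - k) * fact k ^ 4)"
  using assms
proof (induction k)
  case 0
  then show ?case by (simp add: legendre_term_def)
next
  case (Suc k)
  have m: "m - k = Suc (m - Suc k)" using Suc.prems by simp
  have r: "real m - real k = real (Suc (m - Suc k))" using Suc.prems by simp
  \<comment> \<open>Bookkeeping for the term ratio: \<open>J\<close>, the top factor of
    \<open>fact (m - k)\<close>, cancels, and the inserted \<open>4 * s * h\<close> is (2k+2)(2k+1),
    which completes \<open>fact (2 * k)\<close>.\<close>
  have frac: "\<sigma> * F * G / (t * (J * g) * z ^ 4) * (- J * a * h / s ^ 3)
      = (- \<sigma>) * (a * F) * (4 * s * h * G) / ((4 * t) * g * (s * z) ^ 4)"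
    if "J \<noteq> 0" "s \<noteq> 0" for \<sigma> F G t J g z a h s :: real
    using that by (simp add: power_mult_distrib power3_eq_cube power4_eq_xxxx mult.assoc)
      (simp only: mult_ac)
  have *: "X * a * (Y * b) * (Z * c) / (s * z) ^ 3 = X * Y * Z / z ^ 3 * (a * b * c / s ^ 3)"
    for X Y Z a b c s z :: real
    by (simp add: power_mult_distrib mult_ac)
  have "legendre_term m (Suc k) = legendre_term m k * ((- real m + k) * (real m + 1 + k) * (1/2 + k) / real (Suc k) ^ 3)"
    unfolding legendre_term_def pochhammer_Suc fact_Suc by (rule *)
  also have "(- real m + real k) = - real (Suc (m - Suc k))" using r by linarith
  also have "legendre_term m k
      = (- 1) ^ k * fact (m + k) * fact (2 * k) / (4 ^ k * (real (Suc (m - Suc k)) * fact (m - Suc k)) * fact k ^ 4)"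
    using Suc m by (simp only: fact_Suc)
  also have "\<dots> * (- real (Suc (m - Suc k)) * (real m + 1 + k) * (1/2 + k) / real (Suc k) ^ 3)
      = (- ((- 1) ^ k)) * ((real m + 1 + k) * fact (m + k)) * (4 * real (Suc k) * (1/2 + k) * fact (2 * k))
        / ((4 * 4 ^ k) * fact (m - Suc k) * (real (Suc k) * fact k) ^ 4)"
    by (rule frac) simp_all
  also have "(real m + 1 + k) * fact (m + k) = fact (m + Suc k)"
    by simp
  also have "4 * real (Suc k) * (1/2 + k) * fact (2 * k) = fact (2 * Suc k)"
    by (simp add: algebra_simps)
  finally show ?case by simp
qed

lemma watson_term_conv: "k \<le> m \<Longrightarrow> real_of_int (watson_term m k) = 4 ^ m * legendre_term m k"
  by (simp add: real_watson_term legendre_term_closed power_diff mult_ac)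

lemma watson_sum:
  "(\<Sum>k\<le>m. watson_term m k) = (if even m then (int (m choose (m div 2)))\<^sup>2 else 0)"
proof -
  have *: "real_of_int (\<Sum>k\<le>m. watson_term m k) = 4 ^ m * (\<Sum>k\<le>m. legendre_term m k)"
    by (simp add: watson_term_conv sum_distrib_left)
  show ?thesis
  proof (cases "even m")
    case True
    then obtain q where q: "m = 2 * q" by blast
    have "real_of_int (\<Sum>k\<le>m. watson_term m k) = real_of_int ((int (m choose (m div 2)))\<^sup>2)"
      unfolding * unfolding q legendre_sum_even
      by (simp add: power_divide power_mult_distrib power_even_eq flip: power_mult)
    thus ?thesis using True by (simp only: of_int_eq_iff if_True)
  next
    case False
    then obtain q where q: "m = 2 * q + 1" by (elim oddE)
    have "real_of_int (\<Sum>k\<le>m. watson_term m k) = 0"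
      unfolding * unfolding q legendre_sum_odd by simp
    thus ?thesis using False by (simp only: of_int_eq_0_iff if_False)
  qed
qed

section \<open>Reduction modulo \<open>p\<close>\<close>

definition W_term :: "nat \<Rightarrow> nat \<Rightarrow> int" where
  "W_term n k = int ((2 * k) choose k) * int ((3 * k) choose k) * int (n choose (3 * k)) * (-3) ^ (n - 3 * k)"

text \<open>The three binomials collapse to a multinomial coefficient, from which term ratios can be
  read off.\<close>

lemma real_W_term:
  assumes "3 * k \<le> n"
  shows "real_of_int (W_term n k) = (-3) ^ (n - 3 * k) * fact n / (fact (n - 3 * k) * fact k ^ 3)"
proof -
  have "3 * k - k = 2 * k" "2 * k - k = k" by auto
  thus ?thesis using assms by (simp add: W_term_def binomial_fact divide_simps power3_eq_cube)
qed

lemma W_term_Suc: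
  assumes "3 * Suc k \<le> n"
  shows "- 27 * (int k + 1) ^ 3 * W_term n (Suc k)
           = (int n - 3 * int k) * (int n - 3 * int k - 1) * (int n - 3 * int k - 2) * W_term n k"
proof -
  define j where "j = n - 3 * Suc k"
  have j: "n = 3 * k + Suc (Suc (Suc j))" using assms by (simp add: j_def)
  have 1: "3 * Suc k \<le> n" "3 * k \<le> n" using j by auto
  have 2: "n - 3 * Suc k = j" "n - 3 * k = Suc (Suc (Suc j))" using j by auto
  have 3: "real n = 3 * k + j + 3" by (simp add: j)
  have "real_of_int (- 27 * (int k + 1) ^ 3 * W_term n (Suc k))
      = real_of_int ((int n - 3 * int k) * (int n - 3 * int k - 1) * (int n - 3 * int k - 2) * W_term n k)"
    unfolding of_int_mult real_W_term[OF 1(1)] real_W_term[OF 1(2)] 2 fact_Suc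
    by (simp add: 3 divide_simps power3_eq_cube) (simp add: algebra_simps)
  thus ?thesis by (simp only: of_int_eq_iff)
qed

lemma watson_term_Suc:
  assumes "k < m"
  shows "2 * (int k + 1) ^ 3 * watson_term m (Suc k)
           = - (int m + int k + 1) * (int m - int k) * (2 * int k + 1) * watson_term m k"
proof -
  define j where "j = m - Suc k"
  have j: "m = k + Suc j" using assms by (simp add: j_def)
  have 1: "Suc k \<le> m" "k \<le> m" using j by auto
  have 2: "m - Suc k = j" "m - k = Suc j" using j by auto
  have 3: "real m = k + j + 1" by (simp add: j)
  have "real_of_int (2 * (int k + 1) ^ 3 * watson_term m (Suc k))
      = real_of_int (- (int m + int k + 1) * (int m - int k) * (2 * int k + 1) * watson_term m k)"
    unfolding of_int_mult real_watson_term[OF 1(1)] real_watson_term[OF 1(2)] 2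
    by (simp add: 3 divide_simps power3_eq_cube power4_eq_xxxx) (simp add: algebra_simps)
  thus ?thesis by (simp only: of_int_eq_iff)
qed

text \<open>Both sides agree at \<open>k = 0\<close>, and their term ratios in \<open>k\<close>
  agree modulo \<open>p\<close>, with denominators that are invertible.\<close>

lemma W_term_cong_watson_term:
  fixes p n m :: nat
  assumes p: "prime p" "p > 3" and n: "p = 2 * n + 1" and m: "n = 3 * m \<or> n = 3 * m + 2" and k: "k \<le> m"
  shows "[4 ^ m * W_term n k = (-3) ^ n * watson_term m k] (mod int p)"
  using k
proof (induction k)
  case 0
  then show ?case by (simp add: W_term_def watson_term_def mult.commute)
next
  case (Suc k)
  have le: "3 * Suc k \<le> n" "k < m" using m Suc.prems by auto
  have IH: "[4 ^ m * W_term n k = (-3) ^ n * watson_term m k] (mod int p)" using Suc by simp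
  \<comment> \<open>Modulo \<open>p\<close>, n is -1/2. Of n - 3k and n - 3k - 2, one equals 3(m -
    k) and the other is congruent to -3(m + k + 1), while n - 3k - 1 is congruent to -3(k + 1/2).
    Eight times the product has the constant 8 * 27 / 2 = 108.\<close>
  have dvd: "int p dvd 8 * ((int n - 3 * int k) * (int n - 3 * int k - 1) * (int n - 3 * int k - 2))
     - 108 * ((int m + int k + 1) * (int m - int k) * (2 * int k + 1))"
    using m
  proof
    assume n3: "n = 3 * m"
    have "8 * ((int n - 3 * int k) * (int n - 3 * int k - 1) * (int n - 3 * int k - 2))
     - 108 * ((int m + int k + 1) * (int m - int k) * (2 * int k + 1))
      = int p * (12 * (int m - int k) * (3 * int m - 9 * int k - 5))"
      by (simp add: n n3 algebra_simps)
    thus ?thesis by simp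
  next
    assume n3: "n = 3 * m + 2"
    have "8 * ((int n - 3 * int k) * (int n - 3 * int k - 1) * (int n - 3 * int k - 2))
     - 108 * ((int m + int k + 1) * (int m - int k) * (2 * int k + 1))
      = int p * (12 * (int m - int k) * (3 * int m - 9 * int k - 1))"
      by (simp add: n n3 algebra_simps)
    thus ?thesis by simp
  qed
  have main: "[(8 * ((int n - 3 * int k) * (int n - 3 * int k - 1) * (int n - 3 * int k - 2))) * (4 ^ m * W_term n k)
     = (108 * ((int m + int k + 1) * (int m - int k) * (2 * int k + 1))) * ((-3) ^ n * watson_term m k)] (mod int p)"
    by (rule cong_mult[OF dvd[folded cong_iff_dvd_diff] IH])
  have W: "(- 216 * (int k + 1) ^ 3) * (4 ^ m * W_term n (Suc k))
     = (8 * ((int n - 3 * int k) * (int n - 3 * int k - 1) * (int n - 3 * int k - 2))) * (4 ^ m * W_term n k)"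
  proof -
    have "(- 216 * (int k + 1) ^ 3) * (4 ^ m * W_term n (Suc k))
       = 8 * 4 ^ m * (- 27 * (int k + 1) ^ 3 * W_term n (Suc k))" by simp
    also have "\<dots> = (8 * ((int n - 3 * int k) * (int n - 3 * int k - 1) * (int n - 3 * int k - 2))) * (4 ^ m * W_term n k)"
      unfolding W_term_Suc[OF le(1)] by simp
    finally show ?thesis .
  qed
  have w: "(- 216 * (int k + 1) ^ 3) * ((-3) ^ n * watson_term m (Suc k))
     = (108 * ((int m + int k + 1) * (int m - int k) * (2 * int k + 1))) * ((-3) ^ n * watson_term m k)"
  proof -
    have "(- 216 * (int k + 1) ^ 3) * ((-3) ^ n * watson_term m (Suc k))
       = - 108 * (-3) ^ n * (2 * (int k + 1) ^ 3 * watson_term m (Suc k))" by simp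
    also have "\<dots> = (108 * ((int m + int k + 1) * (int m - int k) * (2 * int k + 1))) * ((-3) ^ n * watson_term m k)"
      unfolding watson_term_Suc[OF le(2)] by (simp only: mult_minus_left mult_minus_right minus_minus) simp
    finally show ?thesis .
  qed
  have *: "[(- 216 * (int k + 1) ^ 3) * (4 ^ m * W_term n (Suc k))
      = (- 216 * (int k + 1) ^ 3) * ((-3) ^ n * watson_term m (Suc k))] (mod int p)"
    unfolding W w by (fact main)
  \<comment> \<open>Up to sign the common factor is (6(k + 1))^3. It can be cancelled because
    \<open>p > 3\<close> is prime and \<open>k + 1 < p\<close>.\<close>
  have "\<not> p dvd 6"
  proof
    assume "p dvd 6"
    hence "p dvd 2 * 3" by simp
    hence "p dvd 2 \<or> p dvd 3" using p(1) by (simp only: prime_dvd_mult_iff)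
    thus False using p(2) by (auto dest: dvd_imp_le)
  qed
  moreover have "\<not> p dvd Suc k" using le n by (auto dest!: dvd_imp_le)
  ultimately have "\<not> p dvd (6 * Suc k) ^ 3"
    using p(1) by (metis prime_dvd_mult_iff prime_dvd_power)
  hence "coprime p ((6 * Suc k) ^ 3)" using p(1) prime_imp_coprime by blast
  hence "coprime (int p) (int ((6 * Suc k) ^ 3))" by (simp only: coprime_int_iff)
  also have "int ((6 * Suc k) ^ 3) = - (- 216 * (int k + 1) ^ 3)"
    unfolding of_nat_power of_nat_mult power_mult_distrib by (simp add: add.commute)
  finally have "coprime (- 216 * (int k + 1) ^ 3) (int p)"
    by (simp only: coprime_minus_right_iff coprime_commute)
  thus ?case using * by (simp only: cong_mult_lcancel)
qed

lemma W_cong_central_binomial: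
  fixes p n m :: nat
  assumes p: "prime p" "p > 3" and n: "p = 2 * n + 1" and m: "n = 3 * m \<or> n = 3 * m + 2"
  shows "[4 ^ m * W n = (-3) ^ n * (if even m then (int (m choose (m div 2)))\<^sup>2 else 0)] (mod int p)"
proof -
  have "n div 3 = m" using m by auto
  hence "4 ^ m * W n = (\<Sum>k\<le>m. 4 ^ m * W_term n k)"
    by (simp add: W_def W_term_def atLeast0AtMost sum_distrib_left)
  also have "[\<dots> = (\<Sum>k\<le>m. (-3) ^ n * watson_term m k)] (mod int p)"
    by (intro cong_sum W_term_cong_watson_term[OF p n m]) simp
  finally show ?thesis by (simp only: watson_sum flip: sum_distrib_left)
qed

section \<open>Multiplication formulas for factorials modulo \<open>p\<close>\<close>

text \<open>By Wilson, k! (p - 1 - k)! is 1 or -1 modulo \<open>p\<close>, and squaring removes the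
  sign. Each induction step trades the factor p - 1 - k for its negative k + 1.\<close>

lemma wilson_split:
  assumes p: "prime p" and k: "k < p"
  shows "[(fact k * fact (p - 1 - k))\<^sup>2 = (1 :: int)] (mod int p)"
  using k
proof (induction k)
  case 0
  have "[fact (p - 1) = (- 1 :: int)] (mod int p)" using wilson_theorem[OF p] .
  from cong_pow[OF this, of 2] show ?case by simp
next
  case (Suc k)
  have e: "p - 1 - k = Suc (p - 1 - Suc k)" using Suc.prems by simp
  have "int (p - 1 - k) = int p - (1 + int k)" using Suc.prems by (simp add: of_nat_diff)
  hence "[int (p - 1 - k) = - (int k + 1)] (mod int p)" by (simp add: cong_iff_dvd_diff)
  from cong_pow[OF this, of 2] have c: "[(int (p - 1 - k))\<^sup>2 = (int k + 1)\<^sup>2] (mod int p)" by (simp only: power2_minus)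
  have "(fact (Suc k) * fact (p - 1 - Suc k))\<^sup>2 = (int k + 1)\<^sup>2 * (fact k * fact (p - 1 - Suc k))\<^sup>2"
    unfolding fact_Suc of_nat_Suc by (simp only: power_mult_distrib mult_ac add_ac)
  also have "[\<dots> = (int (p - 1 - k))\<^sup>2 * (fact k * fact (p - 1 - Suc k))\<^sup>2] (mod int p)"
    using c by (intro cong_mult) (auto intro: cong_sym)
  also have "(int (p - 1 - k))\<^sup>2 * (fact k * fact (p - 1 - Suc k))\<^sup>2 = (fact k * fact (p - 1 - k))\<^sup>2"
    unfolding e fact_Suc by (simp add: power_mult_distrib mult_ac)
  also have "[\<dots> = 1] (mod int p)" using Suc by simp
  finally show ?case .
qed

lemma prod_falling_fact:
  "s \<le> N \<Longrightarrow> (\<Prod>j<s. int N - int j) * fact (N - s) = fact N"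
proof (induction s)
  case (Suc s)
  have "N - s = Suc (N - Suc s)" using Suc.prems by simp
  moreover have "int N - int s = int (Suc (N - Suc s))" using Suc.prems by simp
  ultimately show ?case using Suc by (simp add: mult_ac)
qed simp

lemma fact_mult_2: "(fact (2 * q) :: int) = (\<Prod>j<q. 2 * int j + 1) * 2 ^ q * fact q"
  by (induction q) (simp_all add: algebra_simps)

lemma fact_mult_3:
  "(fact (3 * q) :: int) = (\<Prod>j<q. 3 * int j + 1) * (\<Prod>j<q. 3 * int j + 2) * 3 ^ q * fact q"
proof (induction q)
  case (Suc q)
  have 3: "3 * Suc q = Suc (Suc (Suc (3 * q)))" by simp
  have e: "(fact (3 * Suc q) :: int) = (3 * int q + 1) * (3 * int q + 2) * (3 * (int q + 1)) * fact (3 * q)"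
    unfolding 3 fact_Suc by (simp add: algebra_simps)
  show ?case
    unfolding e Suc.IH by (simp only: prod.lessThan_Suc power_Suc fact_Suc of_nat_Suc mult_ac add_ac)
qed simp

text \<open>Since c j + b is congruent to -c (N - j), the progression becomes a falling factorial. A
  suitable \<open>N\<close> thus trades a residue class of factors for a quotient of
  factorials.\<close>

lemma prod_arith_progression_cong:
  fixes a b N s :: nat and c :: int
  assumes "[int b = - c * int N] (mod P)" "s \<le> N"
  shows "[(\<Prod>j<s. c * int j + int b) * fact (N - s) = (- c) ^ s * fact N] (mod P)"
proof -
  have "[(\<Prod>j<s. c * int j + int b) = (\<Prod>j<s. (- c) * (int N - int j))] (mod P)"
  proof (rule cong_prod)
    fix j
    have "[c * int j + int b = c * int j + - c * int N] (mod P)"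
      using assms(1) by (intro cong_add) auto
    thus "[c * int j + int b = (- c) * (int N - int j)] (mod P)" by (simp add: algebra_simps)
  qed
  also have "(\<Prod>j<s. (- c) * (int N - int j)) = (- c) ^ s * (\<Prod>j<s. int N - int j)"
    by (simp only: prod.distrib) simp
  finally have "[(\<Prod>j<s. c * int j + int b) * fact (N - s) = (- c) ^ s * (\<Prod>j<s. int N - int j) * fact (N - s)] (mod P)"
    by (rule cong_scalar_right)
  thus ?thesis using prod_falling_fact[OF assms(2)] by (simp add: mult.assoc)
qed

text \<open>The odd factors of (2q)! form a progression with c = 2 and b = 1, and 1 is congruent to
  -2n. Squaring turns (-2)^q 2^q into 16^q.\<close>

lemma fact_duplication_cong:
  assumes p: "p = 2 * n + 1" and q: "q \<le> n"
  shows "[(fact (2 * q) * fact (n - q))\<^sup>2 = 16 ^ q * (fact q * fact n)\<^sup>2] (mod int p)"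
proof -
  have "[int 1 = - 2 * int n] (mod int p)"
    by (simp add: p cong_iff_dvd_diff)
  from prod_arith_progression_cong[OF this q]
  have "[(\<Prod>j<q. 2 * int j + 1) * fact (n - q) * (2 ^ q * fact q) = (- 2) ^ q * fact n * (2 ^ q * fact q)] (mod int p)"
    by (intro cong_scalar_right) simp
  hence "[fact (2 * q) * fact (n - q) = (- 2) ^ q * 2 ^ q * (fact q * fact n)] (mod int p)"
    unfolding fact_mult_2 by (simp only: mult_ac)
  hence "[(fact (2 * q) * fact (n - q))\<^sup>2 = ((- 2) ^ q * 2 ^ q * (fact q * fact n))\<^sup>2] (mod int p)"
    by (rule cong_pow)
  moreover have "((- 2 :: int) ^ q * 2 ^ q)\<^sup>2 = 16 ^ q"
    by (simp add: power2_eq_square flip: power_mult_distrib)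
  ultimately show ?thesis by (simp only: power_mult_distrib[of "_ * _" "fact q * fact n"])
qed

text \<open>
  The factors of \<open>f!\<close> in a nonzero residue class modulo 3 are, after subtracting \<open>p\<close> or \<open>2p\<close>,
  multiples of 3.
\<close>

lemma fact_triplication_cong:
  assumes p: "prime p" and f: "p = 4 * f + 1" and q: "f = 3 * q \<or> f = 3 * q + 1"
  shows "[(fact f :: int) ^ 4 = 3 ^ (2 * f) * (fact q * fact (2 * f - q))\<^sup>2] (mod int p)"
proof -
  \<comment> \<open>\<open>u\<close> and \<open>v\<close> are the values of N for the progressions
    3j + 1 and 3j + 2. They add up to p - 1, so Wilson disposes of u! v!. The remaining factorials
    (N - s)! are f! and (2f + q)!, in an order depending on the case.\<close>
  obtain u v where uv: "u + v = p - 1" "f \<le> u" "2 * f + q \<le> p - 1"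
    and main: "[fact f * (fact f * fact (2 * f + q)) = (-1) ^ (f - q) * 3 ^ f * fact q * (fact u * fact v)] (mod int p)"
  proof (cases "f = 3 * q")
    case True
    have P: "int p = 12 * int q + 1" using f True by simp
    have "[int 1 = - 3 * int (4 * q)] (mod int p)" "[int 2 = - 3 * int (8 * q)] (mod int p)"
      unfolding P cong_iff_dvd_diff by (rule dvdI[of _ _ 1], simp) (rule dvdI[of _ _ 2], simp)
    from this[THEN prod_arith_progression_cong, of q]
    have "[(\<Prod>j<q. 3 * int j + 1) * fact (3 * q) = (- 3) ^ q * fact (4 * q)] (mod int p)"
         "[(\<Prod>j<q. 3 * int j + 2) * fact (7 * q) = (- 3) ^ q * fact (8 * q)] (mod int p)"
      by simp_all
    from cong_scalar_right[OF cong_mult[OF this], of "3 ^ q * fact q"]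
    have "[fact (3 * q) * (fact (3 * q) * fact (7 * q))
       = ((- 3) ^ q * (- 3) ^ q * 3 ^ q) * fact q * (fact (4 * q) * fact (8 * q))] (mod int p)"
      unfolding fact_mult_3[of q] by (simp only: mult_ac)
    moreover have "((- 3) ^ q * (- 3) ^ q * 3 ^ q :: int) = (-1) ^ (f - q) * 3 ^ f"
      by (simp add: True power_mult flip: power_mult_distrib)
    moreover have "2 * f + q = 7 * q" using True by simp
    ultimately have "[fact f * (fact f * fact (2 * f + q))
       = (-1) ^ (f - q) * 3 ^ f * fact q * (fact (4 * q) * fact (8 * q))] (mod int p)"
      by (simp only: True)
    thus ?thesis using True f by (intro that[of "4 * q" "8 * q"]) simp_all
  next
    case False
    hence q: "f = 3 * q + 1" using q by simp
    have P: "int p = 12 * int q + 5" using f q by simp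
    have "[int 1 = - 3 * int (8 * q + 3)] (mod int p)" "[int 2 = - 3 * int (4 * q + 1)] (mod int p)"
      unfolding P cong_iff_dvd_diff by (rule dvdI[of _ _ 2], simp) (rule dvdI[of _ _ 1], simp)
    \<comment> \<open>Up to 3q + 1 the class of 1 modulo 3 has one member more than the class of 2,
      hence \<open>Suc q\<close> against \<open>q\<close>.\<close>
    from prod_arith_progression_cong[OF this(1), of "Suc q"] prod_arith_progression_cong[OF this(2), of q]
    have "[(\<Prod>j<Suc q. 3 * int j + 1) * fact (7 * q + 2) = (- 3) ^ Suc q * fact (8 * q + 3)] (mod int p)"
         "[(\<Prod>j<q. 3 * int j + 2) * fact (3 * q + 1) = (- 3) ^ q * fact (4 * q + 1)] (mod int p)"
      by simp_all
    note cong_scalar_right[OF cong_mult[OF this], of "3 ^ q * fact q"]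
    moreover have fact_f: "(fact (3 * q + 1) :: int)
        = (\<Prod>j<Suc q. 3 * int j + 1) * (\<Prod>j<q. 3 * int j + 2) * 3 ^ q * fact q"
      unfolding Suc_eq_plus1[symmetric] fact_Suc fact_mult_3[of q] prod.lessThan_Suc by simp
    ultimately have "[fact (3 * q + 1) * (fact (3 * q + 1) * fact (7 * q + 2))
       = ((- 3) ^ Suc q * (- 3) ^ q * 3 ^ q) * fact q * (fact (8 * q + 3) * fact (4 * q + 1))] (mod int p)"
      unfolding fact_f by (simp only: mult_ac)
    moreover have "((- 3) ^ Suc q * (- 3) ^ q * 3 ^ q :: int) = (-1) ^ (f - q) * 3 ^ f"
      by (simp add: q power_mult flip: power_mult_distrib)
    moreover have "2 * f + q = 7 * q + 2" using q by simp
    ultimately have main: "[fact f * (fact f * fact (2 * f + q))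
       = (-1) ^ (f - q) * 3 ^ f * fact q * (fact (8 * q + 3) * fact (4 * q + 1))] (mod int p)"
      by (simp only: q)
    show ?thesis using f q by (intro that[OF _ _ _ main]) simp_all
  qed
  have u: "[(fact u * fact v)\<^sup>2 = (1 :: int)] (mod int p)"
  proof -
    have "u < p" "p - 1 - u = v" using uv(1) f by linarith+
    thus ?thesis using wilson_split[OF p, of u] by simp
  qed
  \<comment> \<open>2f + q and 2f - q add up to p - 1, so their factorials are inverse to each other
    up to sign.\<close>
  have v: "[(fact (2 * f + q) * fact (2 * f - q))\<^sup>2 = (1 :: int)] (mod int p)"
    using wilson_split[OF p, of "2 * f + q"] uv f by simp
  have "(fact f :: int) ^ 4 = fact f ^ 4 * 1" by simp
  also have "[\<dots> = fact f ^ 4 * (fact (2 * f + q) * fact (2 * f - q))\<^sup>2] (mod int p)"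
    using v by (intro cong_mult) (auto intro: cong_sym)
  also have "fact f ^ 4 * (fact (2 * f + q) * fact (2 * f - q))\<^sup>2
     = (fact f * (fact f * fact (2 * f + q)))\<^sup>2 * (fact (2 * f - q) :: int)\<^sup>2"
    by (simp add: power_mult_distrib power2_eq_square power4_eq_xxxx)
  also have "[\<dots> = ((-1) ^ (f - q) * 3 ^ f * fact q * (fact u * fact v))\<^sup>2 * (fact (2 * f - q))\<^sup>2] (mod int p)"
    by (intro cong_scalar_right cong_pow main)
  also have "((-1) ^ (f - q) * 3 ^ f * fact q * (fact u * fact v))\<^sup>2 * (fact (2 * f - q))\<^sup>2
     = 3 ^ (2 * f) * (fact q * fact (2 * f - q))\<^sup>2 * ((fact u * fact v)\<^sup>2 :: int)"
    by (simp add: power_mult_distrib mult_ac flip: power_mult)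
  also have "[\<dots> = 3 ^ (2 * f) * (fact q * fact (2 * f - q))\<^sup>2 * 1] (mod int p)"
    by (intro cong_scalar_left u)
  finally show ?thesis by simp
qed

text \<open>Duplication with n = 2f expresses binom(2q, q) through q!, (2f - q)! and (2f)!;
  triplication eliminates (f!)^4 in favour of the same q! and (2f - q)!, which are prime to
  \<open>p\<close> and cancel. With m = 2q and n = 2f this links Watson's value to Gauss's
  binomial.\<close>

lemma central_binomial_triplication:
  assumes p: "prime p" and f: "p = 4 * f + 1" and q: "f = 3 * q \<or> f = 3 * q + 1"
  shows "[(int ((2 * q) choose q))\<^sup>2 = 16 ^ q * 3 ^ (2 * f) * (int ((2 * f) choose f))\<^sup>2] (mod int p)"
proof -
  define c d Q R N P where defs: "c = int ((2 * f) choose f)" "d = int ((2 * q) choose q)"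
    "Q = (fact q :: int)" "R = (fact (2 * f - q) :: int)" "N = (fact (2 * f) :: int)" "P = (fact f :: int)"
  have c: "c * P\<^sup>2 = N"
    using binomial_fact_lemma[of f "2 * f", THEN arg_cong[of _ _ int]]
    by (simp add: defs mult_2 power2_eq_square mult_ac)
  have d: "fact (2 * q) = d * Q\<^sup>2"
    using binomial_fact_lemma[of q "2 * q", THEN arg_cong[of _ _ int]]
    by (simp add: defs mult_2 power2_eq_square mult_ac)
  have 1: "[(d * Q\<^sup>2 * R)\<^sup>2 = 16 ^ q * (Q * N)\<^sup>2] (mod int p)"
    using fact_duplication_cong[of p "2 * f" q] f q by (auto simp add: d defs)
  have 2: "[P ^ 4 = 3 ^ (2 * f) * (Q * R)\<^sup>2] (mod int p)"
    using fact_triplication_cong[OF p f q] by (simp add: defs)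
  have ndvd: "\<not> int p dvd fact k" if "k < p" for k
    using prime_dvd_fact_iff[OF p, of k] that by (metis int_dvd_int_iff of_nat_fact not_le)
  have "\<not> int p dvd Q" "\<not> int p dvd R"
    using ndvd[of q] ndvd[of "2 * f - q"] q f unfolding defs by auto
  hence "coprime (Q ^ 4 * R\<^sup>2) (int p)"
    using p prime_imp_coprime[of "int p"] by (auto simp: coprime_commute)
  moreover have "[Q ^ 4 * R\<^sup>2 * d\<^sup>2 = Q ^ 4 * R\<^sup>2 * (16 ^ q * 3 ^ (2 * f) * c\<^sup>2)] (mod int p)"
  proof -
    have "Q ^ 4 * R\<^sup>2 * d\<^sup>2 = (d * Q\<^sup>2 * R)\<^sup>2"
      by (simp add: power_mult_distrib flip: power_mult)
    also have "[\<dots> = 16 ^ q * (Q * N)\<^sup>2] (mod int p)" by fact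
    also have "16 ^ q * (Q * N)\<^sup>2 = 16 ^ q * Q\<^sup>2 * c\<^sup>2 * P ^ 4"
      by (simp add: power_mult_distrib mult_ac flip: c power_mult)
    also have "[\<dots> = 16 ^ q * Q\<^sup>2 * c\<^sup>2 * (3 ^ (2 * f) * (Q * R)\<^sup>2)] (mod int p)"
      by (intro cong_scalar_left 2)
    also have "16 ^ q * Q\<^sup>2 * c\<^sup>2 * (3 ^ (2 * f) * (Q * R)\<^sup>2) = Q ^ 4 * R\<^sup>2 * (16 ^ q * 3 ^ (2 * f) * c\<^sup>2)"
      by (simp add: power_mult_distrib power2_eq_square power4_eq_xxxx)
    finally show ?thesis .
  qed
  ultimately show ?thesis by (simp add: cong_mult_lcancel defs)
qed

section \<open>Jacobsthal sums\<close>

text \<open>An affine map with invertible slope permutes the residues; the substitutions in the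
  character sums below rest on this.\<close>

lemma sum_residues_affine:
  fixes g :: "int \<Rightarrow> 'a :: comm_monoid_add"
  assumes p: "prime p" and c: "\<not> int p dvd c" and g: "\<And>x y. [x = y] (mod int p) \<Longrightarrow> g x = g y"
  shows "(\<Sum>x\<in>{0..<int p}. g (c * x + d)) = (\<Sum>x\<in>{0..<int p}. g x)"
proof -
  define h where "h x = (c * x + d) mod int p" for x
  have p0: "int p > 0" using p prime_gt_0_nat by simp
  have "inj_on h {0..<int p}"
  proof
    fix x y assume xy: "x \<in> {0..<int p}" "y \<in> {0..<int p}" "h x = h y"
    hence "[c * x + d = c * y + d] (mod int p)" by (simp add: h_def cong_def)
    hence "[c * x = c * y] (mod int p)" by (simp only: cong_add_rcancel)
    moreover have "coprime c (int p)"
      using p c by (metis coprime_commute prime_imp_coprime prime_nat_int_transfer)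
    ultimately have "[x = y] (mod int p)" by (simp only: cong_mult_lcancel)
    thus "x = y" using xy by (simp add: cong_def)
  qed
  moreover have "h ` {0..<int p} \<subseteq> {0..<int p}" using p0 by (auto simp: h_def)
  ultimately have "bij_betw h {0..<int p} {0..<int p}"
    by (simp add: bij_betw_def endo_inj_surj)
  from sum.reindex_bij_betw[OF this, of g] show ?thesis
    by (simp add: h_def cong_def cong: sum.cong flip: g[of "(c * _ + d) mod int p" "c * _ + d"])
qed

section \<open>The Legendre symbol modulo an odd prime\<close>

locale odd_prime =
  fixes p :: nat
  assumes prime: "prime p" and gt2: "p > 2"
begin

abbreviation chi :: "int \<Rightarrow> int" ("\<chi>") where "\<chi> a \<equiv> Legendre a (int p)"

abbreviation residues :: "int set" where "residues \<equiv> {0..<int p}"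

lemma prime_int: "prime (int p)" using prime by simp

lemma chi_cong: "[a = b] (mod int p) \<Longrightarrow> \<chi> a = \<chi> b"
  unfolding Legendre_def QuadRes_def by (simp add: cong_def)

lemma chi_euler: "[\<chi> a = a ^ ((p - 1) div 2)] (mod int p)"
  by (rule euler_criterion[OF prime gt2])

lemma chi_values: "\<chi> a \<in> {-1, 0, 1}"
  by (simp add: Legendre_def)

lemma chi_eq_0_iff: "\<chi> a = 0 \<longleftrightarrow> int p dvd a"
  by (simp add: Legendre_def cong_0_iff)

lemma chi_0 [simp]: "\<chi> 0 = 0"
  by (simp add: chi_eq_0_iff)

lemma chi_square: "\<chi> a ^ 2 = (if int p dvd a then 0 else 1)"
  by (simp add: Legendre_def cong_0_iff)

lemma dvd_small_imp_eq_0: "int p dvd a \<Longrightarrow> \<bar>a\<bar> < int p \<Longrightarrow> a = 0"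
  using dvd_imp_le_int[of a "int p"] by fastforce

lemma cong_abs_imp_eq:
  assumes "[a = b] (mod int p)" "\<bar>a\<bar> \<le> 1" "\<bar>b\<bar> \<le> (1 :: int)"
  shows "a = b"
proof -
  have "int p dvd a - b" using assms(1) by (simp add: cong_iff_dvd_diff)
  moreover have "\<bar>a - b\<bar> < int p" using assms gt2 by linarith
  ultimately have "a - b = 0" by (rule dvd_small_imp_eq_0)
  thus ?thesis by simp
qed

text \<open>By Euler's criterion the symbol is a power modulo \<open>p\<close>, and integers of
  absolute value at most 1 are determined by their class since \<open>p > 2\<close>.\<close>

lemma chi_mult: "\<chi> (a * b) = \<chi> a * \<chi> b"
proof (rule cong_abs_imp_eq)
  have "[\<chi> (a * b) = a ^ ((p - 1) div 2) * b ^ ((p - 1) div 2)] (mod int p)"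
    using chi_euler[of "a * b"] by (simp add: power_mult_distrib)
  also have "[a ^ ((p - 1) div 2) * b ^ ((p - 1) div 2) = \<chi> a * \<chi> b] (mod int p)"
    by (intro cong_mult cong_sym[OF chi_euler])
  finally show "[\<chi> (a * b) = \<chi> a * \<chi> b] (mod int p)" .
  show "\<bar>\<chi> (a * b)\<bar> \<le> 1" "\<bar>\<chi> a * \<chi> b\<bar> \<le> 1"
    using chi_values[of "a * b"] chi_values[of a] chi_values[of b] by auto
qed

lemma chi_mult_square: "\<not> int p dvd t \<Longrightarrow> \<chi> (t\<^sup>2 * a) = \<chi> a"
  by (simp add: chi_mult power2_eq_square) (simp flip: power2_eq_square mult.assoc add: chi_square)

lemmas sum_affine = sum_residues_affine[OF prime]

lemma residues_dvd_iff: "x \<in> residues \<Longrightarrow> int p dvd x \<longleftrightarrow> x = 0"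
  by (auto dest: zdvd_imp_le)

lemma sum_residues_split: "(\<Sum>x\<in>residues. g x) = g 0 + (\<Sum>x\<in>residues - {0}. g x)"
  using gt2 by (intro sum.remove) auto

lemma card_nonzero: "card (residues - {0}) = p - 1"
  using gt2 by simp

section \<open>Power sums and sums of quadratic characters\<close>

lemma fermat_int: "\<not> int p dvd x \<Longrightarrow> [x ^ (p - 1) = 1] (mod int p)"
proof -
  assume "\<not> int p dvd x"
  hence "[(x ^ ((p - 1) div 2)) ^ 2 = 1] (mod int p)"
    using cong_pow[OF cong_sym[OF chi_euler[of x]], of 2] by (simp add: chi_square)
  moreover have "(p - 1) div 2 * 2 = p - 1"
    using prime_odd_nat[OF prime] gt2 by simp
  ultimately show ?thesis by (simp flip: power_mult)
qed

text \<open>If p - 1 divides a positive \<open>e\<close>, Fermat gives p - 1 ones. Otherwise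
  substituting g x for x, with a primitive root g, multiplies the sum by g^e, which is not 1 modulo
  \<open>p\<close>. For \<open>e = 0\<close> the convention \<open>0 ^ 0 = 1\<close> makes the sum
  \<open>p\<close>.\<close>

lemma power_sum_cong:
  "[(\<Sum>x\<in>residues. x ^ e) = (if p - 1 dvd e \<and> e > 0 then -1 else 0)] (mod int p)"
proof (cases "p - 1 dvd e")
  case True
  then obtain k where k: "e = (p - 1) * k" by blast
  have "[(\<Sum>x\<in>residues - {0}. x ^ e) = (\<Sum>x\<in>residues - {0}. 1)] (mod int p)"
  proof (rule cong_sum)
    fix x assume "x \<in> residues - {0}"
    hence "\<not> int p dvd x" using residues_dvd_iff by auto
    from cong_pow[OF fermat_int[OF this], of k] show "[x ^ e = 1] (mod int p)"
      by (simp add: k power_mult)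
  qed
  also have "(\<Sum>x\<in>residues - {0}. (1::int)) = int p - 1"
    using card_nonzero gt2 by (simp add: of_nat_diff)
  finally have *: "[(\<Sum>x\<in>residues - {0}. x ^ e) = int p - 1] (mod int p)" .
  show ?thesis
  proof (cases "e = 0")
    case False
    hence "[(\<Sum>x\<in>residues. x ^ e) = int p - 1] (mod int p)"
      using * by (simp add: sum_residues_split power_0_left)
    also have "[int p - 1 = - 1] (mod int p)" by (simp add: cong_iff_dvd_diff)
    finally show ?thesis using True False by simp
  qed (simp add: cong_0_iff)
next
  case False
  obtain g where g: "residue_primroot p g"
    using prime_primitive_root_exists[of p] prime gt2 by auto
  have gp: "\<not> int p dvd int g"
    using g prime by (metis residue_primroot_def coprime_absorb_left int_dvd_int_iff not_prime_unit totatives_def)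
  have ne: "\<not> [int g ^ e = 1] (mod int p)"
  proof
    assume "[int g ^ e = 1] (mod int p)"
    hence "[g ^ e = 1] (mod p)" by (metis cong_int_iff of_nat_1 of_nat_power)
    hence "ord p g dvd e" by (simp only: ord_divides)
    thus False using g False prime by (simp add: residue_primroot_def totient_prime)
  qed
  define S where "S = (\<Sum>x\<in>residues. x ^ e)"
  \<comment> \<open>\<open>sum_affine\<close> asks for a function that is equal on congruent
    arguments, hence the powers are reduced modulo \<open>p\<close> before substituting.\<close>
  have c: "\<And>x y :: int. [x = y] (mod int p) \<Longrightarrow> x ^ e mod int p = y ^ e mod int p"
    by (metis cong_pow cong_def)
  have "int g ^ e * S = (\<Sum>x\<in>residues. (int g * x + 0) ^ e)"
    by (simp add: S_def sum_distrib_left power_mult_distrib)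
  also have "[\<dots> = (\<Sum>x\<in>residues. (int g * x + 0) ^ e mod int p)] (mod int p)"
    by (intro cong_sum) (simp add: cong_def)
  also have "(\<Sum>x\<in>residues. (int g * x + 0) ^ e mod int p) = (\<Sum>x\<in>residues. x ^ e mod int p)"
    by (rule sum_affine[OF gp, where g = "\<lambda>x. x ^ e mod int p", OF c])
  also have "[\<dots> = S] (mod int p)"
    unfolding S_def by (intro cong_sum) (simp add: cong_def)
  finally have "int p dvd (int g ^ e - 1) * S"
    by (simp add: cong_iff_dvd_diff algebra_simps)
  hence "int p dvd S"
    using ne prime_int by (simp add: prime_dvd_mult_iff cong_iff_dvd_diff)
  thus ?thesis using False by (simp add: S_def cong_0_iff)
qed

text \<open>Euler's criterion gives a power sum with exponent (p - 1)/2, so \<open>p\<close> divides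
  the sum, whose absolute value is at most p - 1.\<close>

lemma sum_chi: "(\<Sum>x\<in>residues. \<chi> x) = 0"
proof -
  have "[(\<Sum>x\<in>residues. \<chi> x) = (\<Sum>x\<in>residues. x ^ ((p - 1) div 2))] (mod int p)"
    by (intro cong_sum chi_euler)
  moreover have "\<not> (p - 1) dvd ((p - 1) div 2)"
  proof
    assume "p - 1 dvd (p - 1) div 2"
    hence "p - 1 \<le> (p - 1) div 2" by (rule dvd_imp_le) (use gt2 in simp)
    thus False using gt2 by linarith
  qed
  ultimately have "[(\<Sum>x\<in>residues. \<chi> x) = 0] (mod int p)"
    using power_sum_cong[of "(p - 1) div 2"] by (auto intro: cong_trans)
  hence "int p dvd (\<Sum>x\<in>residues. \<chi> x)" by (simp only: cong_0_iff)
  moreover have "\<bar>\<Sum>x\<in>residues. \<chi> x\<bar> < int p"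
  proof -
    have "\<bar>\<Sum>x\<in>residues. \<chi> x\<bar> = \<bar>\<Sum>x\<in>residues - {0}. \<chi> x\<bar>"
      by (simp add: sum_residues_split chi_eq_0_iff)
    also have "\<dots> \<le> (\<Sum>x\<in>residues - {0}. 1)"
    proof (intro order.trans[OF sum_abs] sum_mono)
      show "\<bar>\<chi> x\<bar> \<le> 1" for x using chi_values[of x] by auto
    qed
    also have "\<dots> < int p" using card_nonzero gt2 by simp
    finally show ?thesis .
  qed
  ultimately show ?thesis by (rule dvd_small_imp_eq_0)
qed

lemma sum_chi_shift: "(\<Sum>x\<in>residues. \<chi> (x + d)) = 0"
  using sum_affine[of 1 \<chi> d] chi_cong sum_chi prime_int not_prime_unit by auto

lemma nonresidue_exists: obtains r where "\<chi> r = -1"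
proof -
  have "\<exists>r\<in>residues - {0}. \<chi> r \<noteq> 1"
  proof (rule ccontr)
    assume "\<not> ?thesis"
    hence "(\<Sum>x\<in>residues - {0}. \<chi> x) = (\<Sum>x\<in>residues - {0}. 1)" by (intro sum.cong) auto
    also have "\<dots> > 0" using card_nonzero gt2 by simp
    finally show False using sum_chi by (simp add: sum_residues_split chi_eq_0_iff)
  qed
  then obtain r where "r \<in> residues" "r \<noteq> 0" "\<chi> r \<noteq> 1" by blast
  hence "\<chi> r = -1" using chi_values[of r] chi_eq_0_iff[of r] residues_dvd_iff[of r] by auto
  thus thesis by (rule that)
qed

lemma sum_chi_quadratic:
  "(\<Sum>k\<in>residues. \<chi> (k * (k + d))) = (if int p dvd d then int p - 1 else - 1)"
proof -
  define T where "T d = (\<Sum>k\<in>residues. \<chi> (k * (k + d)))" for d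
  have T_cong: "T a = T b" if "[a = b] (mod int p)" for a b
    unfolding T_def using that by (intro sum.cong chi_cong cong_mult cong_add) auto
  have T0: "T 0 = int p - 1"
  proof -
    have "T 0 = (\<Sum>k\<in>residues - {0}. \<chi> k ^ 2)"
      by (simp add: T_def sum_residues_split chi_eq_0_iff chi_mult power2_eq_square)
    also have "\<dots> = (\<Sum>k\<in>residues - {0}. 1)"
      using residues_dvd_iff by (intro sum.cong) (auto simp: chi_square)
    finally show ?thesis using card_nonzero gt2 by (simp add: of_nat_diff)
  qed
  \<comment> \<open>\<open>T d\<close> takes the same value for all nonzero \<open>d\<close>, which then follows from \<open>T 0\<close> and the sum of all \<open>T d\<close>.\<close>
  have T1: "T d = T 1" if "\<not> int p dvd d" for d
  proof -
    have "T d = (\<Sum>k\<in>residues. \<chi> ((d * k + 0) * ((d * k + 0) + d)))"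
      unfolding T_def using that
      by (intro sum_affine[symmetric, where g = "\<lambda>k. \<chi> (k * (k + d))"] chi_cong cong_mult cong_add) auto
    also have "\<dots> = (\<Sum>k\<in>residues. \<chi> (d\<^sup>2 * (k * (k + 1))))"
      by (intro sum.cong refl arg_cong[of _ _ \<chi>]) (simp add: power2_eq_square algebra_simps)
    finally show ?thesis using that by (simp add: chi_mult_square T_def)
  qed
  have "(\<Sum>d\<in>residues. T d) = (\<Sum>k\<in>residues. \<chi> k * (\<Sum>d\<in>residues. \<chi> (d + k)))"
    unfolding T_def sum_distrib_left by (subst sum.swap) (simp add: chi_mult add.commute)
  also have "\<dots> = 0" by (simp add: sum_chi_shift)
  finally have "T 0 + (\<Sum>d\<in>residues - {0}. T d) = 0" by (simp only: sum_residues_split)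
  moreover have "(\<Sum>d\<in>residues - {0}. T d) = (\<Sum>d\<in>residues - {0}. T 1)"
    by (intro sum.cong refl T1) (use residues_dvd_iff in auto)
  moreover have "(\<Sum>d\<in>residues - {0}. T 1) = (int p - 1) * T 1"
    using card_nonzero gt2 by (simp add: of_nat_diff)
  ultimately have "(int p - 1) * (T 1 + 1) = 0" using T0 by (simp add: algebra_simps)
  hence "T 1 = -1" using gt2 by simp
  moreover have "T d = T 0" if "int p dvd d"
    using that by (intro T_cong) (simp add: cong_0_iff)
  ultimately show ?thesis using T0 T1[of d] unfolding T_def[symmetric] by (cases "int p dvd d") simp_all
qed

lemma sum_chi_quadratic_diff:
  "(\<Sum>k\<in>residues. \<chi> ((a - k) * (b - k))) = (if int p dvd a - b then int p - 1 else - 1)"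
proof -
  have "(\<Sum>k\<in>residues. \<chi> ((a - k) * (b - k))) = (\<Sum>k\<in>residues. \<chi> ((a - (-1 * k + a)) * (b - (-1 * k + a))))"
    using prime_int not_prime_unit
    by (intro sum_affine[symmetric, where g = "\<lambda>k. \<chi> ((a - k) * (b - k))"] chi_cong cong_mult cong_diff) auto
  also have "\<dots> = (\<Sum>k\<in>residues. \<chi> (k * (k + (b - a))))"
    by (intro sum.cong) (auto simp: algebra_simps)
  finally show ?thesis unfolding sum_chi_quadratic by (metis dvd_minus_iff minus_diff_eq)
qed

text \<open>The affine curve y^2 = x^3 - k x has \<open>p + jacobsthal k\<close> points modulo
  \<open>p\<close>.\<close>

definition jacobsthal :: "int \<Rightarrow> int" where
  "jacobsthal k = (\<Sum>x\<in>residues. \<chi> (x * (x\<^sup>2 - k)))"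

lemma jacobsthal_cong: "[a = b] (mod int p) \<Longrightarrow> jacobsthal a = jacobsthal b"
  unfolding jacobsthal_def by (intro sum.cong chi_cong cong_mult cong_diff) auto

text \<open>Substituting t x for x takes t^3 out of the argument, so the sum itself changes only by
  the sign \<open>\<chi> t\<close>.\<close>

lemma jacobsthal_mult_square:
  assumes "\<not> int p dvd t"
  shows "(jacobsthal (t\<^sup>2 * k))\<^sup>2 = (jacobsthal k)\<^sup>2"
proof -
  have "jacobsthal (t\<^sup>2 * k) = (\<Sum>x\<in>residues. \<chi> ((t * x + 0) * ((t * x + 0)\<^sup>2 - t\<^sup>2 * k)))"
    unfolding jacobsthal_def using assms
    by (intro sum_affine[symmetric, where g = "\<lambda>x. \<chi> (x * (x\<^sup>2 - t\<^sup>2 * k))"] chi_cong cong_mult cong_diff cong_pow) auto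
  also have "\<dots> = (\<Sum>x\<in>residues. \<chi> (t\<^sup>2 * (t * (x * (x\<^sup>2 - k)))))"
    by (intro sum.cong refl arg_cong[of _ _ \<chi>]) (simp add: power2_eq_square algebra_simps)
  also have "\<dots> = \<chi> t * jacobsthal k"
    using assms by (simp add: chi_mult_square chi_mult[of t] jacobsthal_def sum_distrib_left)
  finally show ?thesis using assms by (simp add: power_mult_distrib chi_square)
qed

lemma jacobsthal_square_eq_if_chi_eq:
  assumes "\<chi> k = \<chi> r" "\<chi> r \<noteq> 0"
  shows "(jacobsthal k)\<^sup>2 = (jacobsthal r)\<^sup>2"
proof -
  have "\<chi> (k * r) = 1" using assms chi_values[of r] by (auto simp: chi_mult)
  then obtain s where s: "[s\<^sup>2 = k * r] (mod int p)"
    by (auto simp: Legendre_def QuadRes_def split: if_splits)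
  have r: "\<not> int p dvd r" and k: "\<not> int p dvd k" using assms by (auto simp flip: chi_eq_0_iff)
  have "\<not> int p dvd s\<^sup>2" using s r k prime_int by (metis cong_dvd_iff prime_dvd_mult_iff)
  hence ps: "\<not> int p dvd s" by (meson dvd_power pos2 dvd_trans)
  have "[r\<^sup>2 * k = s\<^sup>2 * r] (mod int p)"
    using cong_scalar_right[OF s, of r] by (simp add: power2_eq_square mult_ac cong_sym)
  hence "jacobsthal (r\<^sup>2 * k) = jacobsthal (s\<^sup>2 * r)" by (rule jacobsthal_cong)
  thus ?thesis using jacobsthal_mult_square[OF r, of k] jacobsthal_mult_square[OF ps, of r] by simp
qed

end

section \<open>Jacobsthal sums for primes congruent to 1 modulo 4\<close>

locale prime_1_mod_4 = odd_prime +
  assumes mod4: "p mod 4 = 1"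
begin

lemma chi_minus_1: "\<chi> (- 1) = 1"
proof (rule cong_abs_imp_eq)
  have "even ((p - 1) div 2)" using mod4 by presburger
  thus "[\<chi> (- 1) = 1] (mod int p)" using chi_euler[of "-1"] by simp
qed (use chi_values[of "-1"] in auto)

lemma chi_minus: "\<chi> (- a) = \<chi> a"
  using chi_mult[of "-1" a] chi_minus_1 by simp

text \<open>With the square expanded and the sum over \<open>k\<close> done first, a pair x, y
  contributes \<open>\<chi> x * \<chi> y\<close> times p - 1 if x^2 = y^2 modulo \<open>p\<close>
  and times -1 otherwise. The constant -1 vanishes on summation, and each nonzero x keeps p from y =
  x and p from y = -x, as \<open>\<chi> (- 1) = 1\<close>.\<close>

lemma sum_jacobsthal_squares: "(\<Sum>k\<in>residues. (jacobsthal k)\<^sup>2) = 2 * int p * (int p - 1)"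
proof -
  have "(\<Sum>k\<in>residues. (jacobsthal k)\<^sup>2)
      = (\<Sum>k\<in>residues. \<Sum>x\<in>residues. \<Sum>y\<in>residues. \<chi> x * \<chi> y * \<chi> ((x\<^sup>2 - k) * (y\<^sup>2 - k)))"
    unfolding jacobsthal_def power2_eq_square[of "sum _ _"] sum_product by (simp add: chi_mult mult_ac)
  also have "\<dots> = (\<Sum>x\<in>residues. \<Sum>y\<in>residues. \<chi> x * \<chi> y * (\<Sum>k\<in>residues. \<chi> ((x\<^sup>2 - k) * (y\<^sup>2 - k))))"
    unfolding sum_distrib_left by (rule trans[OF sum.swap sum.cong[OF refl sum.swap]])
  also have "\<dots> = (\<Sum>x\<in>residues. \<Sum>y\<in>residues. \<chi> x * \<chi> y * (int p * (if int p dvd x\<^sup>2 - y\<^sup>2 then 1 else 0)) - \<chi> x * \<chi> y)"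
    unfolding sum_chi_quadratic_diff by (intro sum.cong refl) (simp add: algebra_simps)
  also have "\<dots> = (\<Sum>x\<in>residues. \<Sum>y\<in>residues. \<chi> x * \<chi> y * (int p * (if int p dvd x\<^sup>2 - y\<^sup>2 then 1 else 0)))"
    by (simp add: sum_subtractf sum_chi flip: sum_distrib_left)
  also have "\<dots> = (\<Sum>x\<in>residues - {0}. \<Sum>y\<in>residues. \<chi> x * \<chi> y * (int p * (if int p dvd x\<^sup>2 - y\<^sup>2 then 1 else 0)))"
    by (simp add: sum_residues_split[of "\<lambda>x. \<Sum>y\<in>residues. _ x y"] chi_eq_0_iff)
  also have "\<dots> = (\<Sum>x\<in>residues - {0}. 2 * int p)"
  proof (rule sum.cong[OF refl])
    fix x assume x: "x \<in> residues - {0}"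
    have nd: "\<not> int p dvd x" using x residues_dvd_iff by auto
    have iff: "int p dvd x\<^sup>2 - y\<^sup>2 \<longleftrightarrow> y = x \<or> y = int p - x" if y: "y \<in> residues" for y
    proof -
      have "int p dvd x\<^sup>2 - y\<^sup>2 \<longleftrightarrow> int p dvd x - y \<or> int p dvd x + y"
        using prime_int by (simp add: square_diff_square_factored power2_eq_square prime_dvd_mult_iff disj_commute)
      also have "int p dvd x - y \<longleftrightarrow> y = x"
        using x y by (auto simp: cong_def simp flip: cong_iff_dvd_diff)
      also have "int p dvd x + y \<longleftrightarrow> int p dvd (int p - x) - y"
        by (metis add_diff_eq add_uminus_conv_diff diff_diff_add dvd_add_right_iff dvd_minus_iff dvd_refl)
      also have "\<dots> \<longleftrightarrow> y = int p - x"
      proof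
        assume "int p dvd (int p - x) - y"
        moreover have "\<bar>(int p - x) - y\<bar> < int p" using x y by auto
        ultimately have "(int p - x) - y = 0" by (rule dvd_small_imp_eq_0)
        thus "y = int p - x" by simp
      qed simp
      finally show ?thesis .
    qed
    have xx: "x \<noteq> int p - x"
    proof
      assume "x = int p - x"
      hence "int p = 2 * x" by simp
      thus False using mod4 by presburger
    qed
    have "(\<Sum>y\<in>residues. \<chi> x * \<chi> y * (int p * (if int p dvd x\<^sup>2 - y\<^sup>2 then 1 else 0)))
       = (\<Sum>y\<in>{x, int p - x}. \<chi> x * \<chi> y * int p)"
      using x iff by (intro sum.mono_neutral_cong_right) (auto split: if_splits)
    also have "\<dots> = int p * (\<chi> x)\<^sup>2 + int p * (\<chi> x * \<chi> (int p - x))"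
      using xx by (simp add: power2_eq_square mult_ac)
    also have "\<chi> (int p - x) = \<chi> (- x)"
      by (intro chi_cong) (simp add: cong_iff_dvd_diff)
    finally show "(\<Sum>y\<in>residues. \<chi> x * \<chi> y * (int p * (if int p dvd x\<^sup>2 - y\<^sup>2 then 1 else 0))) = 2 * int p"
      using nd by (simp add: chi_minus chi_square flip: power2_eq_square)
  qed
  finally show ?thesis using card_nonzero gt2 by (simp add: of_nat_diff)
qed

text \<open>The squared sum is 0 at 0 and takes one value on nonzero squares and one on nonresidues,
  each class having (p - 1)/2 elements. The second moment therefore fixes the sum of the two
  values.\<close>

lemma jacobsthal_squares:
  assumes r: "\<chi> r = -1"
  shows "(jacobsthal 1)\<^sup>2 + (jacobsthal r)\<^sup>2 = 4 * int p"
proof -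
  have chi1: "\<chi> 1 = 1" using chi_minus[of 1] chi_minus_1 by simp
  have j0: "jacobsthal 0 = 0"
  proof -
    have "jacobsthal 0 = (\<Sum>x\<in>residues. \<chi> x)" unfolding jacobsthal_def
    proof (rule sum.cong[OF refl])
      fix x show "\<chi> (x * (x\<^sup>2 - 0)) = \<chi> x"
        using chi_values[of x] by (auto simp: chi_mult power2_eq_square)
    qed
    thus ?thesis by (simp add: sum_chi)
  qed
  have "2 * (jacobsthal k)\<^sup>2 = (1 + \<chi> k) * (jacobsthal 1)\<^sup>2 + (1 - \<chi> k) * (jacobsthal r)\<^sup>2"
    if "k \<in> residues - {0}" for k
  proof -
    have "\<chi> k \<noteq> 0" using that residues_dvd_iff chi_eq_0_iff by auto
    hence "\<chi> k = 1 \<or> \<chi> k = -1" using chi_values[of k] by auto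
    thus ?thesis
      using jacobsthal_square_eq_if_chi_eq[of k 1] jacobsthal_square_eq_if_chi_eq[of k r] r chi1 by auto
  qed
  hence "2 * (\<Sum>k\<in>residues - {0}. (jacobsthal k)\<^sup>2)
     = (\<Sum>k\<in>residues - {0}. (1 + \<chi> k) * (jacobsthal 1)\<^sup>2 + (1 - \<chi> k) * (jacobsthal r)\<^sup>2)"
    unfolding sum_distrib_left by (intro sum.cong) auto
  also have "\<dots> = (int p - 1 + (\<Sum>k\<in>residues - {0}. \<chi> k)) * (jacobsthal 1)\<^sup>2
      + (int p - 1 - (\<Sum>k\<in>residues - {0}. \<chi> k)) * (jacobsthal r)\<^sup>2"
    unfolding sum.distrib sum_subtractf sum_distrib_right[symmetric]
    using card_nonzero gt2 by (simp add: of_nat_diff)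
  also have "(\<Sum>k\<in>residues - {0}. \<chi> k) = 0"
    using sum_chi by (simp add: sum_residues_split chi_eq_0_iff)
  finally have "2 * (2 * int p * (int p - 1)) = (int p - 1) * ((jacobsthal 1)\<^sup>2 + (jacobsthal r)\<^sup>2)"
    using sum_jacobsthal_squares j0 by (simp add: sum_residues_split algebra_simps)
  hence "(int p - 1) * ((jacobsthal 1)\<^sup>2 + (jacobsthal r)\<^sup>2) = (int p - 1) * (4 * int p)"
    by (simp add: algebra_simps)
  thus ?thesis using gt2 by (simp only: mult_cancel_left) auto
qed

lemma sum_even_function:
  assumes g: "\<And>x. g (int p - x) = (g x :: int)" and g0: "g 0 = 0"
  shows "(\<Sum>x\<in>residues. g x) = 2 * (\<Sum>x\<in>{1..(int p - 1) div 2}. g x)"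
proof -
  define h where "h = (int p - 1) div 2"
  have h: "int p = 2 * h + 1" "h > 0" using mod4 gt2 unfolding h_def by presburger+
  have "residues - {0} = {1..h} \<union> {h + 1..2 * h}" using h by auto
  hence "(\<Sum>x\<in>residues. g x) = (\<Sum>x\<in>{1..h}. g x) + (\<Sum>x\<in>{h + 1..2 * h}. g x)"
    using g0 by (simp add: sum_residues_split sum.union_disjoint)
  also have "(\<Sum>x\<in>{h + 1..2 * h}. g x) = (\<Sum>x\<in>{1..h}. g (int p - x))"
    by (rule sum.reindex_bij_witness[of _ "\<lambda>x. int p - x" "\<lambda>x. int p - x"]) (use h in auto)
  finally show ?thesis using g by (simp add: h_def)
qed

text \<open>Since -1 is a square, x and p - x give equal summands, and \<open>a\<close> sums over
  1..h with h = (p - 1)/2. There the summand is 0 only at x = 1 and is 1 or -1 elsewhere, so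
  \<open>a\<close> has the parity of h - 1, where h is even.\<close>

lemma jacobsthal_1_half_odd: obtains a where "jacobsthal 1 = 2 * a" "odd a"
proof -
  define g where "g x = \<chi> (x * (x\<^sup>2 - 1))" for x
  define h where "h = (int p - 1) div 2"
  have h: "int p = 2 * h + 1" "even h" "h > 1" using mod4 gt2 unfolding h_def by presburger+
  define a where "a = (\<Sum>x\<in>{1..h}. g x)"
  have "g (int p - x) = g x" for x
  proof -
    have "[int p - x = - x] (mod int p)" by (simp add: cong_iff_dvd_diff)
    hence "[(int p - x) * ((int p - x)\<^sup>2 - 1) = (- x) * ((- x)\<^sup>2 - 1)] (mod int p)"
      by (intro cong_mult cong_diff cong_pow) auto
    hence "g (int p - x) = \<chi> (- (x * (x\<^sup>2 - 1)))" unfolding g_def by (intro chi_cong) simp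
    thus ?thesis by (simp add: chi_minus g_def)
  qed
  hence "jacobsthal 1 = 2 * a"
    using sum_even_function[of g] by (simp add: jacobsthal_def g_def a_def h_def chi_eq_0_iff)
  moreover have "odd a"
  proof -
    have "a = g 1 + (\<Sum>x\<in>{2..h}. g x)"
    proof -
      have "{1..h} = insert 1 {2..h}" using h by auto
      thus ?thesis by (simp add: a_def)
    qed
    also have "g 1 = 0" by (simp add: g_def chi_eq_0_iff)
    finally have a: "a = (\<Sum>x\<in>{2..h}. g x)" by simp
    have "odd (g x)" if x: "x \<in> {2..h}" for x
    proof -
      have "\<not> int p dvd x" "\<not> int p dvd x - 1" "\<not> int p dvd x + 1"
        using x h by (auto dest: zdvd_imp_le)
      hence "\<not> int p dvd x * ((x - 1) * (x + 1))"
        using prime_int by (simp add: prime_dvd_mult_iff)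
      also have "x * ((x - 1) * (x + 1)) = x * (x\<^sup>2 - 1)"
        by (simp add: power2_eq_square algebra_simps)
      finally have "\<not> int p dvd x * (x\<^sup>2 - 1)" .
      thus ?thesis using chi_values[of "x * (x\<^sup>2 - 1)"] by (auto simp: g_def chi_eq_0_iff[symmetric])
    qed
    hence "even (\<Sum>x\<in>{2..h}. g x - 1)" by (intro dvd_sum) simp
    moreover have "(\<Sum>x\<in>{2..h}. g x - 1) = a - (h - 1)"
      using h by (simp add: sum_subtractf a)
    ultimately show ?thesis using h by simp
  qed
  ultimately show thesis by (rule that)
qed

text \<open>Euler's criterion replaces each symbol by (x (x^2 - 1))^(2f). After binomial expansion,
  summation over x keeps only the exponent divisible by p - 1 = 4f, which belongs to the middle
  index j = f.\<close>

lemma jacobsthal_1_square_cong: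
  assumes f: "p = 4 * f + 1"
  shows "[(jacobsthal 1)\<^sup>2 = (int ((2 * f) choose f))\<^sup>2] (mod int p)"
proof -
  have n: "(p - 1) div 2 = 2 * f" using f by simp
  have expand: "(x * (x\<^sup>2 - 1)) ^ (2 * f)
      = (\<Sum>j\<le>2 * f. int ((2 * f) choose j) * (-1) ^ (2 * f - j) * x ^ (2 * f + 2 * j))" for x :: int
    using binomial_ring[of "x\<^sup>2" "-1" "2 * f"]
    by (simp add: power_mult_distrib sum_distrib_left power_add mult_ac flip: power_mult)
  have "[jacobsthal 1 = (\<Sum>x\<in>residues. (x * (x\<^sup>2 - 1)) ^ (2 * f))] (mod int p)"
    unfolding jacobsthal_def using chi_euler n by (intro cong_sum) metis
  also have "(\<Sum>x\<in>residues. (x * (x\<^sup>2 - 1)) ^ (2 * f))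
     = (\<Sum>j\<le>2 * f. int ((2 * f) choose j) * (-1) ^ (2 * f - j) * (\<Sum>x\<in>residues. x ^ (2 * f + 2 * j)))"
    unfolding expand sum_distrib_left by (rule sum.swap)
  also have "[\<dots> = (\<Sum>j\<le>2 * f. int ((2 * f) choose j) * (-1) ^ (2 * f - j) * (if j = f then -1 else 0))] (mod int p)"
  proof (intro cong_sum cong_mult cong_refl)
    fix j assume "j \<in> {..2 * f}"
    hence j: "j \<le> 2 * f" by simp
    have "p - 1 dvd 2 * f + 2 * j \<and> 2 * f + 2 * j > 0 \<longleftrightarrow> j = f"
    proof
      assume "p - 1 dvd 2 * f + 2 * j \<and> 2 * f + 2 * j > 0"
      then obtain k where k: "2 * f + 2 * j = 4 * f * k" "k > 0" using f by fastforce
      hence fj: "f + j = f * (2 * k)" by simp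
      have "f > 0" using f gt2 by simp
      \<comment> \<open>The range \<open>j \<le> 2 * f\<close> leaves only the quotient k =
        1.\<close>
      have "f * (2 * k) \<le> f * 3" using fj j by linarith
      hence "k = 1" using \<open>f > 0\<close> k by simp
      thus "j = f" using fj by simp
    qed (use f gt2 in simp)
    thus "[(\<Sum>x\<in>residues. x ^ (2 * f + 2 * j)) = (if j = f then -1 else 0)] (mod int p)"
      using power_sum_cong[of "2 * f + 2 * j"] by simp
  qed
  also have "(\<Sum>j\<le>2 * f. int ((2 * f) choose j) * (-1) ^ (2 * f - j) * (if j = f then -1 else 0))
     = (- ((-1) ^ f)) * int ((2 * f) choose f)"
    by (simp add: if_distrib[of "\<lambda>x. _ * x"] cong: if_cong)
  finally have "[(jacobsthal 1)\<^sup>2 = ((- ((-1) ^ f)) * int ((2 * f) choose f))\<^sup>2] (mod int p)"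
    by (rule cong_pow)
  thus ?thesis by (simp add: power_mult_distrib flip: power_mult)
qed

text \<open>\<open>p\<close> divides x^2 v^2 - u^2 y^2, so after a change of sign of
  \<open>v\<close> it divides x v - u y. The identity (x v - u y)^2 + (x u + y v)^2 = p^2 bounds
  this multiple of \<open>p\<close> strictly below \<open>p\<close>, so it is 0.\<close>

lemma two_squares_odd_unique:
  fixes x y u v :: int
  assumes xy: "int p = x\<^sup>2 + y\<^sup>2" "odd x" and uv: "int p = u\<^sup>2 + v\<^sup>2" "odd u"
  shows "x\<^sup>2 = u\<^sup>2"
proof -
  have *: "x\<^sup>2 = u\<^sup>2" if uv: "int p = u\<^sup>2 + v\<^sup>2" "odd u" and dvd: "int p dvd x * v - u * y" for u v :: int
  proof -
    have "odd (int p)" using mod4 by presburger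
    hence "odd (x\<^sup>2 + y\<^sup>2)" "odd (u\<^sup>2 + v\<^sup>2)" using xy(1) uv(1) by simp_all
    hence "even y" "even v" using xy(2) uv(2) by simp_all
    \<comment> \<open>x u is odd and y v is even; the second square being positive makes the bound
      strict.\<close>
    hence ne: "x * u + y * v \<noteq> 0" using xy uv by (metis even_add even_mult_iff even_zero)
    have id: "(x * v - u * y)\<^sup>2 + (x * u + y * v)\<^sup>2 = (int p)\<^sup>2"
      unfolding power2_eq_square[of "int p"] by (subst xy(1), subst uv(1)) (simp add: power2_eq_square algebra_simps)
    hence "(x * v - u * y)\<^sup>2 < (int p)\<^sup>2" using ne zero_less_power2[of "x * u + y * v"] by linarith
    hence "\<bar>x * v - u * y\<bar> < int p" using power2_less_imp_less[of "\<bar>x * v - u * y\<bar>" "int p"] by simp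
    hence "x * v - u * y = 0" using dvd dvd_small_imp_eq_0 by blast
    hence "(x * v)\<^sup>2 = (u * y)\<^sup>2" by simp
    moreover have "v\<^sup>2 = int p - u\<^sup>2" "y\<^sup>2 = int p - x\<^sup>2" using xy uv by simp_all
    ultimately have "x\<^sup>2 * (int p - u\<^sup>2) = u\<^sup>2 * (int p - x\<^sup>2)"
      by (simp only: power_mult_distrib)
    hence "int p * x\<^sup>2 = int p * u\<^sup>2" by (simp add: algebra_simps)
    thus ?thesis using gt2 by simp
  qed
  have "(x * v - u * y) * (x * v - u * - y) = x\<^sup>2 * v\<^sup>2 - u\<^sup>2 * y\<^sup>2"
    by (simp add: power2_eq_square algebra_simps)
  also have "\<dots> = x\<^sup>2 * (int p - u\<^sup>2) - u\<^sup>2 * (int p - x\<^sup>2)" using xy(1) uv(1) by simp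
  also have "\<dots> = int p * (x\<^sup>2 - u\<^sup>2)" by (simp add: algebra_simps)
  finally have "int p dvd (x * v - u * y) * (x * v - u * - y)" by simp
  hence "int p dvd x * v - u * y \<or> int p dvd x * v - u * - y"
    using prime_int by (simp only: prime_dvd_mult_iff)
  moreover have "x * - v - u * y = - (x * v - u * - y)" by simp
  ultimately have "int p dvd x * v - u * y \<or> int p dvd x * - v - u * y" by (metis dvd_minus_iff)
  thus ?thesis using *[of u v] *[of u "- v"] uv by auto
qed

text \<open>This is \<open>jacobsthal_squares\<close> divided by 4: the first sum is 2a, and the
  second is even because its square is 4p - 4a^2.\<close>

lemma two_squares_exist: obtains a b :: int where "int p = a\<^sup>2 + b\<^sup>2" "odd a" "jacobsthal 1 = 2 * a"
proof -
  obtain a where a: "jacobsthal 1 = 2 * a" "odd a" by (rule jacobsthal_1_half_odd)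
  obtain r where "\<chi> r = -1" by (rule nonresidue_exists)
  from jacobsthal_squares[OF this] have sq: "4 * a\<^sup>2 + (jacobsthal r)\<^sup>2 = 4 * int p"
    by (simp add: a power_mult_distrib)
  hence "(jacobsthal r)\<^sup>2 = 2 * (2 * int p - 2 * a\<^sup>2)" by simp
  hence "even ((jacobsthal r)\<^sup>2)" by simp
  then obtain b where b: "jacobsthal r = 2 * b" by auto
  from sq have "int p = a\<^sup>2 + b\<^sup>2" by (simp add: b power_mult_distrib)
  thus thesis using a by (intro that)
qed

theorem central_binomial_gauss:
  fixes x y :: int
  assumes f: "p = 4 * f + 1" and xy: "int p = x\<^sup>2 + y\<^sup>2" "odd x"
  shows "[(int ((2 * f) choose f))\<^sup>2 = 4 * x\<^sup>2] (mod int p)"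
proof -
  obtain a b :: int where ab: "int p = a\<^sup>2 + b\<^sup>2" "odd a" "jacobsthal 1 = 2 * a"
    by (rule two_squares_exist)
  have "x\<^sup>2 = a\<^sup>2" by (rule two_squares_odd_unique[OF xy ab(1,2)])
  hence "4 * x\<^sup>2 = (jacobsthal 1)\<^sup>2" by (simp add: ab power_mult_distrib)
  thus ?thesis using jacobsthal_1_square_cong[OF f] by (simp add: cong_sym)
qed

end

section \<open>Assembling the congruence for \<open>W\<close>\<close>

theorem theorem2p2:
  fixes p :: nat
  assumes "prime p" and "odd p"
  shows "(p mod 4 = 1 \<longrightarrow>
            (\<exists>x y :: int. int p = x\<^sup>2 + y\<^sup>2 \<and> odd x) \<and>
            (\<forall>x y :: int. int p = x\<^sup>2 + y\<^sup>2 \<and> odd x \<longrightarrow>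
               [W ((p - 1) div 2) = 4 * x\<^sup>2] (mod int p))) \<and>
         (p mod 4 = 3 \<longrightarrow> [W ((p - 1) div 2) = 0] (mod int p))"
proof (cases "p = 3")
  case True
  \<comment> \<open>The comparison of terms divides by 6, so \<open>p = 3\<close> is checked
    directly; it falls under 3 modulo 4.\<close>
  have "W 1 = -3" by (simp add: W_def)
  thus ?thesis by (simp add: True cong_0_iff)
next
  case False
  have gt3: "p > 3" using assms False prime_ge_2_nat[of p] by (cases "p = 2") auto
  define n where "n = (p - 1) div 2"
  define m where "m = n div 3"
  have n: "p = 2 * n + 1" using assms(2) unfolding n_def by presburger
  \<comment> \<open>The excluded class would make p = 2n + 1 divisible by 3.\<close>
  have "n mod 3 \<noteq> 1"
  proof
    assume "n mod 3 = 1"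
    hence "3 dvd p" unfolding n by presburger
    thus False using assms(1) gt3 by (metis less_irrefl prime_nat_iff numeral_eq_one_iff semiring_norm(86))
  qed
  hence m: "n = 3 * m \<or> n = 3 * m + 2" unfolding m_def by presburger
  note W = W_cong_central_binomial[OF assms(1) gt3 n m]
  have coprime: "coprime (4 ^ m :: int) (int p)"
  proof -
    have "coprime (2 :: int) (int p)" using assms(2) by (simp add: coprime_left_2_iff_odd)
    hence "coprime ((2 ^ 2) ^ m :: int) (int p)" unfolding coprime_power_left_iff by blast
    thus ?thesis by (simp only: power2_eq_square) simp
  qed
  have "[W n = 4 * x\<^sup>2] (mod int p)"
    if mod4: "p mod 4 = 1" and xy: "int p = x\<^sup>2 + y\<^sup>2" "odd x" for x y :: int
  proof -
    interpret prime_1_mod_4 p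
      using assms gt3 mod4 by unfold_locales auto
    define f where "f = n div 2"
    define q where "q = m div 2"
    have f: "n = 2 * f" "p = 4 * f + 1" using mod4 n unfolding f_def by presburger+
    have q: "m = 2 * q" using m f(1) unfolding q_def by presburger
    have fq: "f = 3 * q \<or> f = 3 * q + 1" using m f(1) q by auto
    \<comment> \<open>One factor 3^n is (-3)^n with n even, another comes from triplication;
      together they are 3^(p - 1).\<close>
    have fermat: "[(3 :: int) ^ (2 * n) = 1] (mod int p)"
    proof -
      have "\<not> int p dvd 3" using gt3 by (auto dest: zdvd_imp_le)
      from fermat_int[OF this] show ?thesis using n by simp
    qed
    define c where "c = (int (n choose f))\<^sup>2"
    have 4: "(4 :: int) ^ m = 16 ^ q" by (simp add: q power_mult)
    have "[4 ^ m * W n = 3 ^ n * (int ((2 * q) choose q))\<^sup>2] (mod int p)"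
      using W q f(1) by simp
    also have "[3 ^ n * (int ((2 * q) choose q))\<^sup>2 = 3 ^ n * (16 ^ q * 3 ^ n * c)] (mod int p)"
      unfolding c_def f(1) by (intro cong_scalar_left central_binomial_triplication assms f(2) fq)
    also have "3 ^ n * (16 ^ q * 3 ^ n * c) = 4 ^ m * (3 ^ (2 * n) * c)"
      by (simp add: 4 mult_2 power_add)
    also have "[4 ^ m * (3 ^ (2 * n) * c) = 4 ^ m * (1 * c)] (mod int p)"
      by (intro cong_scalar_left cong_scalar_right fermat)
    finally have "[W n = c] (mod int p)" using coprime by (simp add: cong_mult_lcancel)
    also have "[c = 4 * x\<^sup>2] (mod int p)"
      unfolding c_def f(1) by (rule central_binomial_gauss[OF f(2) xy])
    finally show ?thesis .
  qed
  moreover have "\<exists>x y :: int. int p = x\<^sup>2 + y\<^sup>2 \<and> odd x" if mod4: "p mod 4 = 1"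
  proof -
    interpret prime_1_mod_4 p
      using assms gt3 mod4 by unfold_locales auto
    show ?thesis using two_squares_exist by metis
  qed
  moreover have "[W n = 0] (mod int p)" if "p mod 4 = 3"
  proof -
    \<comment> \<open>Here n is odd, and 3m as well as 3m + 2 has the parity of
      \<open>m\<close>.\<close>
    have "odd m" using m that n by presburger
    with W have "[4 ^ m * W n = 4 ^ m * 0] (mod int p)" by simp
    thus ?thesis using coprime by (simp only: cong_mult_lcancel)
  qed
  ultimately show ?thesis unfolding n_def by blast
qed

end
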